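(* Let $\bm{A}^{(i)}=\bigl[A^{(i)}_{rs}\bigr]_{r,s=1}^n\in\mathbb{M}_n(\mathbb{M}_k)$, $i=1,2,\ldots,m$, be positive semidefinite. Then $$\det\left(\prod_{i=1}^m\circ\,\bm{A}^{(i)}\right)+(m-1)\prod_{i=1}^m\left(\det\bm{A}^{(i)}\right)\ \ge\ \sum_{i=1}^m\left(\Bigl(\prod_{j=1,\,j\ne i}^m\det\bm{A}^{(j)}\Bigr)\cdot\prod_{\mu=1}^n\det A^{(i)}_{\mu\mu}\right).$$
   Context: $\mathbb{M}_n(\mathbb{M}_k)$ denotes the set of $n\times n$ block matrices $\bm{A}=[A_{rs}]_{r,s=1}^n$ whose blocks $A_{rs}$ are complex $k\times k$ matrices; such a matrix is regarded as an $nk\times nk$ complex matrix, and positive semidefinite means Hermitian positive semidefinite as an $nk\times nk$ matrix. $A^{(i)}_{\mu\mu}$ is the $\mu$-th diagonal $k\times k$ block of $\bm{A}^{(i)}$. For matrices $A=[a_{ij}]$, $B=[b_{ij}]$ of the same size, the Hadamard product is the entrywise product $A\circ B=[a_{ij}b_{ij}]$, and $\prod_{i=1}^m\circ\,\bm{A}^{(i)}$ denotes the (entrywise, $nk\times nk$) Hadamard product $\bm{A}^{(1)}\circ\cdots\circ\bm{A}^{(m)}$.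
   Formalization: The formal theorem assumes m ≥ 2; for m = 1 the displayed inequality would say det A ≥ ∏ det A_μμ, the reverse of Fischer's inequality, which fails e.g. for k = 1, n = 2 and A the all-ones matrix (0 ≥ 1). *)

theory Defs
  imports "Jordan_Normal_Form.Schur_Decomposition"
begin

text \<open>
  An element of \<open>M\<^sub>n(M\<^sub>k)\<close> is an \<open>nk \<times> nk\<close> complex matrix. As usual for \<^typ>\<open>'a mat\<close>, all
  indices (of entries, of blocks, and of the family of matrices) start at 0. The order on
  \<^typ>\<open>complex\<close> is that of \<^theory>\<open>HOL-Library.Complex_Order\<close>: \<open>x \<le> y\<close> iff \<open>Re x \<le> Re y\<close> and
  \<open>Im x = Im y\<close>.
\<close>

definition hermitian_mat :: "complex mat \<Rightarrow> bool" where
  "hermitian_mat A \<longleftrightarrow> square_mat A \<and> mat_adjoint A = A"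

definition psd_mat :: "complex mat \<Rightarrow> bool" where
  "psd_mat A \<longleftrightarrow> hermitian_mat A \<and> (\<forall>v \<in> carrier_vec (dim_row A). 0 \<le> (A *\<^sub>v v) \<bullet>c v)"

definition block :: "nat \<Rightarrow> 'a mat \<Rightarrow> nat \<Rightarrow> nat \<Rightarrow> 'a mat" where
  "block k A r s = mat k k (\<lambda>(a, b). A $$ (r * k + a, s * k + b))"

definition hadamard :: "'a :: times mat \<Rightarrow> 'a mat \<Rightarrow> 'a mat" (infixl \<open>\<circ>\<^sub>H\<close> 70) where
  "A \<circ>\<^sub>H B = mat (dim_row A) (dim_col A) (\<lambda>(a, b). A $$ (a, b) * B $$ (a, b))"

text \<open>\<open>A 0 \<circ>\<^sub>H A 1 \<circ>\<^sub>H \<dots> \<circ>\<^sub>H A (m - 1)\<close>; only meaningful for \<open>m \<ge> 1\<close>.\<close>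

definition hadamard_prod :: "nat \<Rightarrow> (nat \<Rightarrow> 'a :: times mat) \<Rightarrow> 'a mat" where
  "hadamard_prod m A = foldl (\<circ>\<^sub>H) (A 0) (map A [1..<m])"

lemma hadamard_prod_1: "hadamard_prod 1 A = A 0"
  by (simp add: hadamard_prod_def)

lemma hadamard_prod_Suc: "m \<ge> 1 \<Longrightarrow> hadamard_prod (Suc m) A = hadamard_prod m A \<circ>\<^sub>H A m"
  by (simp add: hadamard_prod_def)

lemma hadamard_prod_eq_mat:
  fixes A :: "nat \<Rightarrow> 'a :: comm_monoid_mult mat"
  assumes "m \<ge> 1" and "\<And>i. i < m \<Longrightarrow> A i \<in> carrier_mat nr nc"
  shows "hadamard_prod m A = mat nr nc (\<lambda>ab. \<Prod>i<m. A i $$ ab)"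
  using assms
proof (induction m rule: nat_induct_at_least)
  case base
  then show ?case by (auto simp: hadamard_prod_def)
next
  case (Suc m)
  then show ?case by (auto simp: hadamard_prod_Suc hadamard_def)
qed

end

theory Submission
  imports Defs
begin

text \<open>
  By Hadamard's inequality for the diagonal blocks, each \<open>det (block k (A i) \<mu> \<mu>)\<close> is at most the product
  of its diagonal entries, so block size 1 suffices; the case of several factors then follows from the
  Oppenheim--Schur inequality for two factors by induction on \<open>m\<close>. For two positive semidefinite
  matrices \<open>a\<close>, \<open>b\<close> of size \<open>n + 1\<close>, let \<open>\<alpha>\<close> and \<open>\<beta>\<close> be their last pivots: lowering the corner entry by
  the pivot keeps the matrix positive semidefinite, and the determinant is the pivot times the leading
  minor of size \<open>n\<close>. By the Schur product theorem, lowering the corner of \<open>a \<circ> b\<close> by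
  \<open>t = \<alpha> b\<^sub>n\<^sub>n + \<beta> a\<^sub>n\<^sub>n - \<alpha> \<beta>\<close> keeps it positive semidefinite, so its determinant is at least \<open>t\<close> times
  its leading minor, and induction on the size applies.
\<close>

section \<open>Hermitian forms, Schur complements and the Schur product theorem\<close>

definition herm_form :: "'a set \<Rightarrow> ('a \<Rightarrow> 'a \<Rightarrow> complex) \<Rightarrow> ('a \<Rightarrow> complex) \<Rightarrow> complex" where
  "herm_form S a v = (\<Sum>i\<in>S. cnj (v i) * (\<Sum>j\<in>S. a i j * v j))"

text \<open>Arbitrary index sets in place of matrices: principal submatrices and Schur complements
  keep their indices, and induction can remove any one index.\<close>

definition psd_on :: "'a set \<Rightarrow> ('a \<Rightarrow> 'a \<Rightarrow> complex) \<Rightarrow> bool" where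
  "psd_on S a \<longleftrightarrow> (\<forall>i\<in>S. \<forall>j\<in>S. a j i = cnj (a i j)) \<and> (\<forall>v. 0 \<le> herm_form S a v)"

lemma psd_onD:
  assumes "psd_on S a"
  shows "\<And>i j. i \<in> S \<Longrightarrow> j \<in> S \<Longrightarrow> a j i = cnj (a i j)" "\<And>v. 0 \<le> herm_form S a v"
  using assms unfolding psd_on_def by blast+

lemma psd_mat_iff_psd_on:
  assumes "A \<in> carrier_mat n n"
  shows "psd_mat A \<longleftrightarrow> psd_on {..<n} (\<lambda>i j. A $$ (i, j))"
proof -
  have adj: "mat_adjoint A = mat n n (\<lambda>(i, j). cnj (A $$ (j, i)))"
    using assms by (auto simp: mat_adjoint_def mat_of_rows_def intro!: eq_matI)
  have "hermitian_mat A \<longleftrightarrow> (\<forall>i\<in>{..<n}. \<forall>j\<in>{..<n}. A $$ (j, i) = cnj (A $$ (i, j)))"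
  proof -
    have "hermitian_mat A \<longleftrightarrow> (\<forall>i<n. \<forall>j<n. cnj (A $$ (j, i)) = A $$ (i, j))"
      unfolding hermitian_mat_def adj mat_eq_iff using assms by (simp add: square_mat.simps)
    then show ?thesis
      by (metis lessThan_iff)
  qed
  moreover have form: "(A *\<^sub>v v) \<bullet>c v = herm_form {..<n} (\<lambda>i j. A $$ (i, j)) (\<lambda>i. v $ i)"
    if "v \<in> carrier_vec n" for v
    using assms that
    by (auto simp: herm_form_def scalar_prod_def atLeast0LessThan mult.commute intro!: sum.cong)
  have "(\<forall>v\<in>carrier_vec n. 0 \<le> (A *\<^sub>v v) \<bullet>c v) \<longleftrightarrow>
      (\<forall>v. 0 \<le> herm_form {..<n} (\<lambda>i j. A $$ (i, j)) v)"
  proof safe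
    fix v :: "nat \<Rightarrow> complex"
    assume *: "\<forall>v\<in>carrier_vec n. 0 \<le> (A *\<^sub>v v) \<bullet>c v"
    have "herm_form {..<n} (\<lambda>i j. A $$ (i, j)) v = (A *\<^sub>v vec n v) \<bullet>c vec n v"
      by (subst form) (auto simp: herm_form_def)
    with * show "0 \<le> herm_form {..<n} (\<lambda>i j. A $$ (i, j)) v"
      by simp
  qed (simp add: form)
  ultimately show ?thesis
    using assms by (simp add: psd_mat_def psd_on_def)
qed

text \<open>Serves to extend a vector by zero and, with a singleton \<open>S\<close>, to evaluate
  the form at a unit vector.\<close>

lemma herm_form_mono_neutral:
  assumes "finite T" "S \<subseteq> T" "\<And>i. i \<in> T - S \<Longrightarrow> v i = 0" "\<And>i. i \<in> S \<Longrightarrow> v i = w i"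
  shows "herm_form T a v = herm_form S a w"
proof -
  have "(\<Sum>j\<in>T. a i j * v j) = (\<Sum>j\<in>S. a i j * w j)" for i
    using assms by (intro sum.mono_neutral_cong_right) auto
  then show ?thesis
    using assms unfolding herm_form_def by (intro sum.mono_neutral_cong_right) auto
qed

lemma psd_on_subset:
  assumes "psd_on T a" "finite T" "S \<subseteq> T"
  shows "psd_on S a"
  unfolding psd_on_def
proof safe
  fix v :: "'a \<Rightarrow> complex"
  have "herm_form T a (\<lambda>i. if i \<in> S then v i else 0) = herm_form S a v"
    using assms by (intro herm_form_mono_neutral) auto
  then show "0 \<le> herm_form S a v"
    using psd_onD(2)[OF assms(1)] by metis
qed (use assms psd_onD(1)[OF assms(1)] in blast)

lemma psd_on_diag:
  assumes "psd_on S a" "finite S" "i \<in> S"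
  shows "0 \<le> a i i"
  using psd_onD(2)[OF psd_on_subset[OF assms(1,2), of "{i}"], of "\<lambda>_. 1"] assms(3)
  by (simp add: herm_form_def)

text \<open>Hermitian symmetry makes the two cross terms conjugate to each other, so both can be
  expressed through \<open>b u z\<close>.\<close>

lemma herm_form_add:
  assumes "psd_on S a"
  defines "b \<equiv> \<lambda>u z. \<Sum>i\<in>S. cnj (u i) * (\<Sum>j\<in>S. a i j * z j)"
  shows "herm_form S a (\<lambda>i. u i + c * z i) =
    herm_form S a u + c * b u z + cnj (c * b u z) + cnj c * c * herm_form S a z"
proof -
  have "cnj (b u z) = (\<Sum>i\<in>S. \<Sum>j\<in>S. u i * (cnj (a i j) * cnj (z j)))"
    by (simp add: b_def sum_distrib_left)
  also have "\<dots> = (\<Sum>j\<in>S. \<Sum>i\<in>S. u i * (cnj (a i j) * cnj (z j)))"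
    by (rule sum.swap)
  also have "\<dots> = b z u"
    unfolding b_def sum_distrib_left
  proof (intro sum.cong refl)
    fix j i assume "j \<in> S" "i \<in> S"
    then show "u i * (cnj (a i j) * cnj (z j)) = cnj (z j) * (a j i * u i)"
      using psd_onD(1)[OF assms(1), of i j] by simp
  qed
  finally have "cnj (b u z) = b z u" .
  moreover have "herm_form S a (\<lambda>i. u i + c * z i) =
      herm_form S a u + c * b u z + cnj c * b z u + cnj c * c * herm_form S a z"
    by (simp add: herm_form_def b_def sum.distrib sum_distrib_left algebra_simps)
  ultimately show ?thesis
    by simp
qed

text \<open>Let \<open>s\<close> be the \<open>i\<close>-th entry of the image of the null vector
  \<open>v\<close>. Moving from the unit vector \<open>e\<close> along \<open>v\<close> changes the
  form linearly, since the quadratic term vanishes; for nonzero \<open>s\<close> it would become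
  negative far enough out.\<close>

lemma psd_on_null:
  assumes a: "psd_on S a" and "finite S" "herm_form S a v = 0" "i \<in> S"
  shows "(\<Sum>j\<in>S. a i j * v j) = 0"
proof (rule ccontr)
  define s where "s = (\<Sum>j\<in>S. a i j * v j)"
  define e where "e = (\<lambda>j. if j = i then 1 else 0 :: complex)"
  assume "(\<Sum>j\<in>S. a i j * v j) \<noteq> 0"
  then have s: "norm s > 0"
    by (simp add: s_def)
  have delta: "(\<Sum>j\<in>S. cnj (e j) * f j) = f i" "(\<Sum>j\<in>S. f j * e j) = f i" for f
    using assms by (simp_all add: e_def if_distrib [of cnj] sum.delta if_distrib [of "\<lambda>x. x * _"]
        if_distrib [of "\<lambda>x. _ * x"] cong: if_cong)
  have *: "0 \<le> Re (a i i) - 2 * t * (norm s)\<^sup>2" for t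
  proof -
    have "herm_form S a (\<lambda>j. e j + (- of_real t * cnj s) * v j) =
        a i i + (- of_real t * cnj s) * s + cnj ((- of_real t * cnj s) * s)"
      using herm_form_add[OF a, where u = e and c = "- of_real t * cnj s" and z = v]
        assms(3)
      by (simp add: delta s_def herm_form_def[of S a e])
    moreover have "Re (herm_form S a (\<lambda>j. e j + (- of_real t * cnj s) * v j)) \<ge> 0"
      using psd_onD(2)[OF a] by (simp add: less_eq_complex_def)
    moreover have "cnj s * s = of_real ((norm s)\<^sup>2)"
      using complex_norm_square[of s] by (simp add: mult.commute)
    ultimately show ?thesis
      by (simp add: mult.assoc)
  qed
  \<comment> \<open>This \<open>t\<close> makes the bound in \<open>*\<close> equal to -1.\<close>
  from *[of "(Re (a i i) + 1) / (2 * (norm s)\<^sup>2)"] s show False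
    by (simp add: field_simps)
qed

text \<open>Completing the square: the complement's form at \<open>v\<close> is the value of the
  original form at \<open>v\<close> with a suitable entry in position \<open>p\<close>.\<close>

lemma psd_on_schur_complement:
  assumes a: "psd_on (insert p S) a" and "finite S" "p \<notin> S"
  shows "psd_on S (\<lambda>i j. a i j - a i p * a p j / a p p)"
proof (cases "a p p = 0")
  \<comment> \<open>Division by zero yields 0, so the complement is just the restriction of
    \<open>a\<close>.\<close>
  case True
  then show ?thesis
    using psd_on_subset[OF a, of S] assms by auto
next
  case False
  note herm = psd_onD(1)[OF a]
  have app: "cnj (a p p) = a p p"
    using herm[of p p] by simp
  show ?thesis
    unfolding psd_on_def
  proof safe
    fix i j assume "i \<in> S" "j \<in> S"
    then have "a j i = cnj (a i j)" "a i p = cnj (a p i)" "a p j = cnj (a j p)"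
      using herm by blast+
    then show "a j i - a j p * a p i / a p p = cnj (a i j - a i p * a p j / a p p)"
      using app by simp
  next
    fix v :: "'a \<Rightarrow> complex"
    define u where "u = v(p := 0)"
    define e where "e = (\<lambda>j. if j = p then 1 else 0 :: complex)"
    define s where "s = (\<Sum>j\<in>S. a p j * v j)"
    \<comment> \<open>The entry in position \<open>p\<close> that minimises the form of
      \<open>u + c * e\<close>.\<close>
    define c where "c = - s / a p p"
    have uu: "herm_form (insert p S) a u = herm_form S a v"
      using assms by (intro herm_form_mono_neutral) (auto simp: u_def)
    have "(\<Sum>i\<in>insert p S. cnj (u i) * (\<Sum>j\<in>insert p S. a i j * e j)) =
        (\<Sum>i\<in>insert p S. cnj (u i) * a i p)"
      using assms by (simp add: e_def if_distrib [of "\<lambda>x. _ * x"] cong: if_cong)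
    also have "\<dots> = (\<Sum>i\<in>S. cnj (v i) * a i p)"
      using assms by (auto simp: u_def intro!: sum.cong)
    also have cnj_s: "(\<Sum>i\<in>S. cnj (v i) * a i p) = cnj s"
      unfolding s_def cnj_sum
    proof (rule sum.cong)
      fix i assume "i \<in> S"
      then show "cnj (v i) * a i p = cnj (a p i * v i)"
        using herm[of p i] by simp
    qed simp
    finally have ue: "(\<Sum>i\<in>insert p S. cnj (u i) * (\<Sum>j\<in>insert p S. a i j * e j)) = cnj s" .
    have ee: "herm_form (insert p S) a e = a p p"
      by (subst herm_form_mono_neutral[where S = "{p}" and w = e])
        (use assms in \<open>auto simp: e_def herm_form_def\<close>)
    have "0 \<le> herm_form S a v + c * cnj s + cnj (c * cnj s) + cnj c * c * a p p"
      using psd_onD(2)[OF a, of "\<lambda>i. u i + c * e i"]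
      unfolding herm_form_add[OF a, where u = u and c = c and z = e] uu ue ee .
    also have "\<dots> = herm_form S a v - cnj s * (s / a p p)"
      using False app by (simp add: c_def field_simps)
    also have "cnj s * (s / a p p) = (\<Sum>i\<in>S. cnj (v i) * (\<Sum>j\<in>S. a i p * a p j / a p p * v j))"
      unfolding cnj_s[symmetric] unfolding s_def sum_divide_distrib sum_product
      unfolding sum_distrib_left by (intro sum.cong refl) simp
    also have "herm_form S a v - \<dots> = herm_form S (\<lambda>i j. a i j - a i p * a p j / a p p) v"
      by (simp add: herm_form_def algebra_simps sum_subtractf)
    finally show "0 \<le> herm_form S (\<lambda>i j. a i j - a i p * a p j / a p p) v" .
  qed
qed

text \<open>Cholesky-style induction: column \<open>p\<close> divided by the square root of the
  pivot \<open>a p p\<close> gives one rank-one term, and the Schur complement supplies the others.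
  These are unconstrained at \<open>p\<close>, so they are reset to 0 there.\<close>

lemma psd_on_gram:
  assumes "finite S" "psd_on S a"
  shows "\<exists>gs. \<forall>i\<in>S. \<forall>j\<in>S. a i j = (\<Sum>g\<leftarrow>gs. g i * cnj (g j))"
  using assms
proof (induction S arbitrary: a rule: finite_induct)
  case empty
  then show ?case by simp
next
  case (insert p S)
  note herm = psd_onD(1)[OF insert.prems]
  obtain gs where gs: "\<And>i j. i \<in> S \<Longrightarrow> j \<in> S \<Longrightarrow>
      a i j - a i p * a p j / a p p = (\<Sum>g\<leftarrow>gs. g i * cnj (g j))"
    using insert.IH[OF psd_on_schur_complement[OF insert.prems insert.hyps]] by blast
  define r where "r = complex_of_real (sqrt (Re (a p p)))"
  have "0 \<le> a p p"
    using psd_on_diag[OF insert.prems] insert.hyps by simp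
  then have r: "r * r = a p p" "cnj r = r"
    by (simp_all add: r_def less_eq_complex_def complex_eq_iff flip: of_real_mult)
  define g0 where "g0 = (\<lambda>i. a i p / r)"
  define hs where "hs = g0 # map (\<lambda>g. g(p := 0)) gs"
  have g0: "g0 i * cnj (g0 j) = a i p * a p j / a p p" if "i \<in> insert p S" "j \<in> insert p S" for i j
    using r herm[of j p] that by (simp add: g0_def)
  \<comment> \<open>With a zero pivot the unit vector at \<open>p\<close> is null, so column
    \<open>p\<close> vanishes, in agreement with \<open>g0\<close> being 0 by division by
    zero.\<close>
  have zero: "a i p = 0" if "i \<in> insert p S" "a p p = 0" for i
  proof -
    define e where "e = (\<lambda>j. if j = p then 1 else 0 :: complex)"
    have "herm_form (insert p S) a e = 0"
      by (subst herm_form_mono_neutral[where S = "{p}" and w = e])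
        (use insert.hyps that in \<open>auto simp: e_def herm_form_def\<close>)
    from psd_on_null[OF insert.prems _ this that(1)] insert.hyps show ?thesis
      by (simp add: e_def if_distrib [of "\<lambda>x. _ * x"] cong: if_cong)
  qed
  have "a i j = (\<Sum>g\<leftarrow>hs. g i * cnj (g j))" if ij: "i \<in> insert p S" "j \<in> insert p S" for i j
  proof (cases "i = p \<or> j = p")
    case True
    then have "(\<Sum>g\<leftarrow>hs. g i * cnj (g j)) = a i p * a p j / a p p"
      using g0[OF ij] by (auto simp: hs_def comp_def)
    also have "\<dots> = a i j"
      using True zero[of i] zero[of j] herm[of j p] ij by (cases "a p p = 0") auto
    finally show ?thesis by simp
  next
    case False
    then show ?thesis
      using g0[OF ij] gs[of i j] ij by (simp add: hs_def comp_def algebra_simps)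
  qed
  then show ?case by blast
qed

text \<open>Each rank-one term \<open>g i * cnj (g j)\<close> of \<open>a\<close> can be absorbed
  into the vector, which turns the form of the product into a sum of values of the form of
  \<open>b\<close>.\<close>

lemma psd_on_mult:
  assumes "finite S" "psd_on S a" "psd_on S b"
  shows "psd_on S (\<lambda>i j. a i j * b i j)"
  unfolding psd_on_def
proof safe
  fix i j assume "i \<in> S" "j \<in> S"
  then have "a j i = cnj (a i j)" "b j i = cnj (b i j)"
    using psd_onD(1)[OF assms(2)] psd_onD(1)[OF assms(3)] by blast+
  then show "a j i * b j i = cnj (a i j * b i j)"
    by simp
next
  fix v :: "'a \<Rightarrow> complex"
  obtain gs where gs: "\<And>i j. i \<in> S \<Longrightarrow> j \<in> S \<Longrightarrow> a i j = (\<Sum>g\<leftarrow>gs. g i * cnj (g j))"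
    using psd_on_gram[OF assms(1,2)] by blast
  have "herm_form S (\<lambda>i j. a i j * b i j) v =
      (\<Sum>i\<in>S. \<Sum>j\<in>S. \<Sum>g\<leftarrow>gs. cnj (v i) * (g i * cnj (g j) * b i j * v j))"
    unfolding herm_form_def sum_distrib_left
  proof (intro sum.cong refl)
    fix i j assume "i \<in> S" "j \<in> S"
    then show "cnj (v i) * (a i j * b i j * v j) =
        (\<Sum>g\<leftarrow>gs. cnj (v i) * (g i * cnj (g j) * b i j * v j))"
      by (simp only: gs sum_list_const_mult sum_list_mult_const)
  qed
  also have "\<dots> = (\<Sum>g\<leftarrow>gs. herm_form S b (\<lambda>i. cnj (g i) * v i))"
  proof (induction gs)
    case (Cons g gs)
    have "herm_form S b (\<lambda>i. cnj (g i) * v i) =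
        (\<Sum>i\<in>S. \<Sum>j\<in>S. cnj (v i) * (g i * cnj (g j) * b i j * v j))"
      unfolding herm_form_def sum_distrib_left by (intro sum.cong refl) simp
    with Cons.IH show ?case
      by (simp add: sum.distrib)
  qed simp
  also have "\<dots> \<ge> 0"
    by (intro sum_list_nonneg) (auto intro: psd_onD(2)[OF assms(3)])
  finally show "0 \<le> herm_form S (\<lambda>i j. a i j * b i j) v" .
qed


section \<open>Cofactor expansions and the last pivot\<close>

lemma det_last_row:
  assumes "\<And>i j. i < n \<Longrightarrow> j < Suc n \<Longrightarrow> b i j = a i j" "\<And>j. j < n \<Longrightarrow> b n j = a n j"
    and "b n n = a n n + t"
  shows "det (mat (Suc n) (Suc n) (\<lambda>(i, j). b i j)) =
    det (mat (Suc n) (Suc n) (\<lambda>(i, j). a i j)) + t * det (mat n n (\<lambda>(i, j). a i j))"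
proof -
  define A where "A = mat (Suc n) (Suc n) (\<lambda>(i, j). a i j)"
  define B where "B = mat (Suc n) (Suc n) (\<lambda>(i, j). b i j)"
  \<comment> \<open>The two matrices differ only in the last row, so their cofactors along that row
    agree.\<close>
  have "mat_delete B n j = mat_delete A n j" if "j < Suc n" for j
    using assms(1) that by (intro eq_matI) (auto simp: mat_delete_def A_def B_def)
  then have cof: "cofactor B n j = cofactor A n j" if "j < Suc n" for j
    using that by (simp add: cofactor_def)
  have "mat_delete A n n = mat n n (\<lambda>(i, j). a i j)"
    by (intro eq_matI) (auto simp: mat_delete_def A_def)
  then have cof_n: "cofactor A n n = det (mat n n (\<lambda>(i, j). a i j))"
    by (simp add: cofactor_def flip: mult_2 power_add)
  have "det B = (\<Sum>j<Suc n. B $$ (n, j) * cofactor B n j)"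
    by (rule laplace_expansion_row) (auto simp: B_def)
  also have "\<dots> = (\<Sum>j<Suc n. A $$ (n, j) * cofactor A n j) + t * cofactor A n n"
  proof -
    have "B $$ (n, j) = A $$ (n, j)" if "j < n" for j
      using assms(2) that by (simp add: A_def B_def)
    moreover have "B $$ (n, n) = A $$ (n, n) + t"
      using assms(3) by (simp add: A_def B_def)
    ultimately show ?thesis
      by (simp add: cof algebra_simps)
  qed
  also have "(\<Sum>j<Suc n. A $$ (n, j) * cofactor A n j) = det A"
    by (rule laplace_expansion_row[symmetric]) (auto simp: A_def)
  finally show ?thesis
    unfolding cof_n unfolding A_def B_def .
qed

text \<open>\<open>z\<close> is the last column of the adjugate, and the equations are the last
  column of \<open>A * adj_mat A\<close>. Without any division this also covers a singular leading
  block.\<close>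

lemma last_column_adjugate:
  fixes a :: "nat \<Rightarrow> nat \<Rightarrow> 'a :: comm_ring_1"
  obtains z where "z n = det (mat n n (\<lambda>(i, j). a i j))"
    "\<And>i. i < Suc n \<Longrightarrow> (\<Sum>j<Suc n. a i j * z j) =
      (if i = n then det (mat (Suc n) (Suc n) (\<lambda>(i, j). a i j)) else 0)"
proof -
  define A where "A = mat (Suc n) (Suc n) (\<lambda>(i, j). a i j)"
  have A: "A \<in> carrier_mat (Suc n) (Suc n)"
    by (simp add: A_def)
  have "mat_delete A n n = mat n n (\<lambda>(i, j). a i j)"
    by (intro eq_matI) (auto simp: mat_delete_def A_def)
  then have diag: "cofactor A n n = det (mat n n (\<lambda>(i, j). a i j))"
    by (simp add: cofactor_def flip: mult_2 power_add)
  have "(\<Sum>j<Suc n. a i j * cofactor A n j) =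
      (if i = n then det (mat (Suc n) (Suc n) (\<lambda>(i, j). a i j)) else 0)" if i: "i < Suc n" for i
  proof -
    have "(\<Sum>j<Suc n. a i j * cofactor A n j) = (A * adj_mat A) $$ (i, n)"
      using i by (auto simp: adj_mat_def A_def scalar_prod_def atLeast0LessThan intro!: sum.cong)
    also have "\<dots> = (if i = n then det A else 0)"
      using i by (simp add: adj_mat(2)[OF A])
    finally show ?thesis
      by (simp add: A_def)
  qed
  with diag show ?thesis
    using that[of "\<lambda>j. cofactor A n j"] by blast
qed

text \<open>Split \<open>v\<close> as \<open>u + v n * z\<close> with \<open>u n = 0\<close>. The
  image of \<open>z\<close> lives at index \<open>n\<close> only, so \<open>u\<close> and
  \<open>z\<close> are orthogonal for the form, and subtracting \<alpha> at the corner removes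
  exactly the contribution of \<open>z\<close>.\<close>

lemma psd_on_diff_null:
  assumes a: "psd_on {..<Suc n} a"
    and z: "z n = 1" "\<And>i. i < Suc n \<Longrightarrow> (\<Sum>j<Suc n. a i j * z j) = (if i = n then \<alpha> else 0)"
  shows "0 \<le> \<alpha>" "psd_on {..<Suc n} (\<lambda>i j. a i j - (if i = n \<and> j = n then \<alpha> else 0))"
proof -
  have form_z: "herm_form {..<Suc n} a z = \<alpha>"
    using z by (simp add: herm_form_def del: sum.lessThan_Suc)
      (simp add: if_distrib[of "\<lambda>x. _ * x"] z(1) cong: if_cong)
  then show \<alpha>: "0 \<le> \<alpha>"
    using psd_onD(2)[OF a] by metis
  then have cnj_\<alpha>: "cnj \<alpha> = \<alpha>"
    by (simp add: less_eq_complex_def complex_eq_iff)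
  define b where "b = (\<lambda>i j. a i j - (if i = n \<and> j = n then \<alpha> else 0))"
  have form_b: "herm_form {..<Suc n} b v = herm_form {..<Suc n} a v - \<alpha> * (cnj (v n) * v n)" for v
    by (simp add: herm_form_def b_def algebra_simps)
  have "0 \<le> herm_form {..<Suc n} b v" for v
  proof -
    define u where "u = (\<lambda>i. v i - v n * z i)"
    have "(\<Sum>i<Suc n. cnj (u i) * (\<Sum>j<Suc n. a i j * z j)) = 0"
      using z by (intro sum.neutral) (auto simp: u_def)
    then have "herm_form {..<Suc n} a (\<lambda>i. u i + v n * z i) =
        herm_form {..<Suc n} a u + cnj (v n) * v n * \<alpha>"
      using herm_form_add[OF a, where u = u and c = "v n" and z = z] form_z by simp
    moreover have "(\<lambda>i. u i + v n * z i) = v"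
      by (simp add: u_def)
    ultimately have "herm_form {..<Suc n} b v = herm_form {..<Suc n} a u"
      by (simp add: form_b)
    then show ?thesis
      using psd_onD(2)[OF a] by simp
  qed
  moreover have "b j i = cnj (b i j)" if "i \<in> {..<Suc n}" "j \<in> {..<Suc n}" for i j
    using psd_onD(1)[OF a, of i j] that cnj_\<alpha> by (auto simp: b_def)
  ultimately have "psd_on {..<Suc n} b"
    unfolding psd_on_def by blast
  then show "psd_on {..<Suc n} (\<lambda>i j. a i j - (if i = n \<and> j = n then \<alpha> else 0))"
    by (simp only: b_def)
qed

text \<open>
  If the leading minor is nonzero, the vector \<open>z\<close> of \<open>psd_on_diff_null\<close> is the normalised last column of
  the adjugate. If it vanishes, that column is a zero of the Hermitian form, hence in the kernel, so
  the full determinant vanishes as well and \<open>\<alpha> = 0\<close> will do.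
\<close>

lemma psd_on_pivot:
  assumes a: "psd_on {..<Suc n} a"
  obtains \<alpha> where "0 \<le> \<alpha>" "psd_on {..<Suc n} (\<lambda>i j. a i j - (if i = n \<and> j = n then \<alpha> else 0))"
    "det (mat (Suc n) (Suc n) (\<lambda>(i, j). a i j)) = \<alpha> * det (mat n n (\<lambda>(i, j). a i j))"
proof -
  define D where "D = det (mat (Suc n) (Suc n) (\<lambda>(i, j). a i j))"
  define d where "d = det (mat n n (\<lambda>(i, j). a i j))"
  obtain z where z: "z n = d" "\<And>i. i < Suc n \<Longrightarrow> (\<Sum>j<Suc n. a i j * z j) = (if i = n then D else 0)"
    using last_column_adjugate unfolding D_def d_def by blast
  show ?thesis
  proof (cases "d = 0")
    case True
    have "herm_form {..<Suc n} a z = 0"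
      using z True by (simp add: herm_form_def del: sum.lessThan_Suc)
    then have "(\<Sum>j<Suc n. a n j * z j) = 0"
      by (intro psd_on_null[OF a]) auto
    then have "D = 0"
      using z by simp
    with True show ?thesis
      using that[of 0] a by (simp add: D_def d_def)
  next
    case False
    have "(\<Sum>j<Suc n. a i j * (z j / d)) = (if i = n then D / d else 0)" if "i < Suc n" for i
    proof -
      have "(\<Sum>j<Suc n. a i j * (z j / d)) = (\<Sum>j<Suc n. a i j * z j) / d"
        by (simp only: sum_divide_distrib times_divide_eq_right)
      then show ?thesis
        by (simp only: z(2)[OF that]) simp
    qed
    note null = psd_on_diff_null[OF a, of "\<lambda>j. z j / d", OF _ this]
    show ?thesis
    proof (rule that)
      show "det (mat (Suc n) (Suc n) (\<lambda>(i, j). a i j)) = D / d * det (mat n n (\<lambda>(i, j). a i j))"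
        using False unfolding D_def d_def by simp
    qed (use null z(1) False in simp_all)
  qed
qed


section \<open>Hadamard's inequality and the Oppenheim--Schur inequality for two factors\<close>

lemma det_psd_bounds:
  assumes "psd_on {..<n} a"
  shows "0 \<le> det (mat n n (\<lambda>(i, j). a i j))" "det (mat n n (\<lambda>(i, j). a i j)) \<le> (\<Prod>i<n. a i i)"
proof -
  \<comment> \<open>Both bounds go through one induction: multiplying the upper bounds on the pivot
    and on the minor requires the minor to be nonnegative.\<close>
  have "0 \<le> det (mat n n (\<lambda>(i, j). a i j)) \<and> det (mat n n (\<lambda>(i, j). a i j)) \<le> (\<Prod>i<n. a i i)"
    using assms
  proof (induction n)
    case 0
    then show ?case by (simp add: det_dim_zero less_eq_complex_def)
  next
    case (Suc n)
    obtain \<alpha> where \<alpha>: "0 \<le> \<alpha>"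
        "psd_on {..<Suc n} (\<lambda>i j. a i j - (if i = n \<and> j = n then \<alpha> else 0))"
        "det (mat (Suc n) (Suc n) (\<lambda>(i, j). a i j)) = \<alpha> * det (mat n n (\<lambda>(i, j). a i j))"
      using psd_on_pivot[OF Suc.prems] .
    \<comment> \<open>The lowered corner is still a diagonal entry of a positive semidefinite
      kernel.\<close>
    have "\<alpha> \<le> a n n"
      using psd_on_diag[OF \<alpha>(2), of n] by simp
    moreover have "0 \<le> det (mat n n (\<lambda>(i, j). a i j)) \<and> det (mat n n (\<lambda>(i, j). a i j)) \<le> (\<Prod>i<n. a i i)"
      using Suc psd_on_subset[OF Suc.prems, of "{..<n}"] by auto
    ultimately show ?case
      using \<alpha> by (auto simp: mult.commute[of _ "a n n"] intro!: mult_mono')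
  qed
  then show "0 \<le> det (mat n n (\<lambda>(i, j). a i j))" "det (mat n n (\<lambda>(i, j). a i j)) \<le> (\<Prod>i<n. a i i)"
    by blast+
qed

lemma oppenheim_schur:
  assumes "psd_on {..<n} a" "psd_on {..<n} b"
  shows "det (mat n n (\<lambda>(i, j). a i j)) * (\<Prod>i<n. b i i) + det (mat n n (\<lambda>(i, j). b i j)) * (\<Prod>i<n. a i i)
    \<le> det (mat n n (\<lambda>(i, j). a i j * b i j))
      + det (mat n n (\<lambda>(i, j). a i j)) * det (mat n n (\<lambda>(i, j). b i j))"
  using assms
proof (induction n)
  case 0
  then show ?case by (simp add: det_dim_zero less_eq_complex_def)
next
  case (Suc n)
  define P R C where "P = det (mat n n (\<lambda>(i, j). a i j))" "R = det (mat n n (\<lambda>(i, j). b i j))"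
    "C = det (mat n n (\<lambda>(i, j). a i j * b i j))"
  define T Q where "T = (\<Prod>i<n. a i i)" "Q = (\<Prod>i<n. b i i)"
  have sub: "psd_on {..<n} a" "psd_on {..<n} b"
    using Suc.prems by (auto intro: psd_on_subset)
  have bounds: "0 \<le> P" "P \<le> T" "0 \<le> R" "R \<le> Q"
    using det_psd_bounds[OF sub(1)] det_psd_bounds[OF sub(2)] by (simp_all add: P_R_C_def T_Q_def)
  obtain \<alpha> where \<alpha>: "0 \<le> \<alpha>"
      "psd_on {..<Suc n} (\<lambda>i j. a i j - (if i = n \<and> j = n then \<alpha> else 0))"
      "det (mat (Suc n) (Suc n) (\<lambda>(i, j). a i j)) = \<alpha> * P"
    using psd_on_pivot[OF Suc.prems(1)] unfolding P_R_C_def .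
  obtain \<beta> where \<beta>: "0 \<le> \<beta>"
      "psd_on {..<Suc n} (\<lambda>i j. b i j - (if i = n \<and> j = n then \<beta> else 0))"
      "det (mat (Suc n) (Suc n) (\<lambda>(i, j). b i j)) = \<beta> * R"
    using psd_on_pivot[OF Suc.prems(2)] unfolding P_R_C_def .
  define x y where "x = a n n" "y = b n n"
  have \<alpha>x: "\<alpha> \<le> x" and \<beta>y: "\<beta> \<le> y"
    using psd_on_diag[OF \<alpha>(2), of n] psd_on_diag[OF \<beta>(2), of n] by (simp_all add: x_y_def)
  \<comment> \<open>\<open>t\<close> equals \<open>x * y - (x - \<alpha>) * (y - \<beta>)\<close>,
    the drop of the product's corner when both factors are lowered by their pivots.\<close>
  define t where "t = \<alpha> * y + \<beta> * (x - \<alpha>)"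
  have "0 \<le> t"
    using \<alpha> \<beta> \<alpha>x \<beta>y by (auto simp: t_def intro!: add_nonneg_nonneg mult_nonneg_nonneg)
  have "P * Q + R * T - P * R \<le> C"
    using Suc.IH[OF sub] by (simp add: P_R_C_def T_Q_def algebra_simps)
  then have "t * (P * Q + R * T - P * R) \<le> t * C"
    using \<open>0 \<le> t\<close> by (rule mult_left_mono)
  also have "t * C \<le> det (mat (Suc n) (Suc n) (\<lambda>(i, j). a i j * b i j))"
  proof -
    \<comment> \<open>\<open>?c\<close> differs from the entrywise product only at the corner, by
      \<open>t\<close>; its determinant is therefore the full one minus \<open>t * C\<close>, and it
      is nonnegative by the Schur product theorem.\<close>
    let ?c = "\<lambda>i j. (a i j - (if i = n \<and> j = n then \<alpha> else 0)) * (b i j - (if i = n \<and> j = n then \<beta> else 0))"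
    have "0 \<le> det (mat (Suc n) (Suc n) (\<lambda>(i, j). ?c i j))"
      using psd_on_mult[OF _ \<alpha>(2) \<beta>(2)] by (intro det_psd_bounds(1)) auto
    moreover have "det (mat (Suc n) (Suc n) (\<lambda>(i, j). ?c i j)) =
        det (mat (Suc n) (Suc n) (\<lambda>(i, j). a i j * b i j)) + - t * C"
      unfolding P_R_C_def by (rule det_last_row) (auto simp: t_def x_y_def algebra_simps)
    ultimately show ?thesis
      by simp
  qed
  finally have "t * (P * Q + R * T - P * R) \<le> det (mat (Suc n) (Suc n) (\<lambda>(i, j). a i j * b i j))" .
  \<comment> \<open>The difference of the two sides factors into terms that are nonnegative because
    pivots are at most corner entries and, by Hadamard, minors are at most diagonal
    products.\<close>
  moreover have "\<alpha> * P * (Q * y) + \<beta> * R * (T * x) - \<alpha> * P * (\<beta> * R) \<le> t * (P * Q + R * T - P * R)"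
  proof -
    have "0 \<le> P * \<beta> * (x - \<alpha>) * (Q - R) + R * \<alpha> * (y - \<beta>) * (T - P)"
      using \<alpha> \<beta> \<alpha>x \<beta>y bounds by (intro add_nonneg_nonneg mult_nonneg_nonneg) simp_all
    also have "\<dots> = t * (P * Q + R * T - P * R) - (\<alpha> * P * (Q * y) + \<beta> * R * (T * x) - \<alpha> * P * (\<beta> * R))"
      by (simp add: t_def algebra_simps)
    finally show ?thesis
      by simp
  qed
  ultimately have "\<alpha> * P * (Q * y) + \<beta> * R * (T * x) - \<alpha> * P * (\<beta> * R)
      \<le> det (mat (Suc n) (Suc n) (\<lambda>(i, j). a i j * b i j))"
    by (rule order_trans[rotated])
  then show ?case
    using \<alpha>(3) \<beta>(3) by (simp add: T_Q_def x_y_def algebra_simps)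
qed

section \<open>Diagonal blocks\<close>

lemma prod_nonneg_complex:
  fixes f :: "'a \<Rightarrow> complex"
  assumes "\<And>i. i \<in> I \<Longrightarrow> 0 \<le> f i"
  shows "0 \<le> prod f I"
  using assms by (induction I rule: infinite_finite_induct) (auto simp: less_eq_complex_def[of 0 1])

lemma prod_mono_complex:
  fixes f g :: "'a \<Rightarrow> complex"
  assumes "\<And>i. i \<in> I \<Longrightarrow> 0 \<le> f i" "\<And>i. i \<in> I \<Longrightarrow> f i \<le> g i"
  shows "prod f I \<le> prod g I"
  using assms
  by (induction I rule: infinite_finite_induct) (auto intro!: mult_mono' prod_nonneg_complex)

lemma psd_on_reindex:
  assumes "psd_on (h ` S) a" "inj_on h S"
  shows "psd_on S (\<lambda>i j. a (h i) (h j))"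
  unfolding psd_on_def
proof safe
  fix v :: "'b \<Rightarrow> complex"
  have "herm_form (h ` S) a (v \<circ> inv_into S h) = herm_form S (\<lambda>i j. a (h i) (h j)) v"
    using assms(2) by (simp add: herm_form_def sum.reindex)
  then show "0 \<le> herm_form S (\<lambda>i j. a (h i) (h j)) v"
    using psd_onD(2)[OF assms(1)] by metis
qed (use psd_onD(1)[OF assms(1)] in blast)

text \<open>The block is the principal submatrix on an interval of \<open>k\<close> indices; shifted
  to start at 0 it falls under Hadamard's inequality.\<close>

lemma det_block_bounds:
  assumes "A \<in> carrier_mat (n * k) (n * k)" "psd_mat A" "\<mu> < n"
  shows "0 \<le> det (block k A \<mu> \<mu>)" "det (block k A \<mu> \<mu>) \<le> (\<Prod>i\<in>{\<mu> * k..<\<mu> * k + k}. A $$ (i, i))"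
proof -
  have "\<mu> * k + k \<le> n * k"
    using assms(3) mult_le_mono1[of "Suc \<mu>" n k] by simp
  moreover have img: "(\<lambda>i. \<mu> * k + i) ` {..<k} = {\<mu> * k..<\<mu> * k + k}"
    using image_add_atLeastLessThan[of "\<mu> * k" 0 k] by (simp add: atLeast0LessThan add.commute)
  ultimately have "psd_on ((\<lambda>i. \<mu> * k + i) ` {..<k}) (\<lambda>i j. A $$ (i, j))"
    using assms psd_mat_iff_psd_on[OF assms(1)] by (auto intro: psd_on_subset)
  then have psd: "psd_on {..<k} (\<lambda>i j. A $$ (\<mu> * k + i, \<mu> * k + j))"
    by (rule psd_on_reindex) simp
  have "(\<Prod>i\<in>{\<mu> * k..<\<mu> * k + k}. A $$ (i, i)) = (\<Prod>i<k. A $$ (\<mu> * k + i, \<mu> * k + i))"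
    unfolding img[symmetric] by (subst prod.reindex) auto
  then show "0 \<le> det (block k A \<mu> \<mu>)" "det (block k A \<mu> \<mu>) \<le> (\<Prod>i\<in>{\<mu> * k..<\<mu> * k + k}. A $$ (i, i))"
    using det_psd_bounds[OF psd] by (simp_all add: block_def)
qed

lemma prod_det_block_le:
  assumes "A \<in> carrier_mat (n * k) (n * k)" "psd_mat A"
  shows "(\<Prod>\<mu><n. det (block k A \<mu> \<mu>)) \<le> (\<Prod>i<n * k. A $$ (i, i))"
proof -
  have "(\<Prod>\<mu><n. det (block k A \<mu> \<mu>)) \<le> (\<Prod>\<mu><n. \<Prod>i\<in>{\<mu> * k..<\<mu> * k + k}. A $$ (i, i))"
    using det_block_bounds[OF assms] by (intro prod_mono_complex) auto
  \<comment> \<open>The \<open>n\<close> consecutive intervals of length \<open>k\<close> tile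
    \<open>{..<n * k}\<close>.\<close>
  also have "\<dots> = (\<Prod>i<n * k. A $$ (i, i))"
    by (rule prod.nat_group)
  finally show ?thesis .
qed

section \<open>Transfer to matrices and induction on the number of factors\<close>

lemma psd_mat_det_bounds:
  assumes "A \<in> carrier_mat n n" "psd_mat A"
  shows "0 \<le> det A" "det A \<le> (\<Prod>i<n. A $$ (i, i))"
proof -
  have "A = mat n n (\<lambda>(i, j). A $$ (i, j))"
    using assms(1) by auto
  then show "0 \<le> det A" "det A \<le> (\<Prod>i<n. A $$ (i, i))"
    using det_psd_bounds[of n "\<lambda>i j. A $$ (i, j)"] assms psd_mat_iff_psd_on by metis+
qed

lemma psd_mat_hadamard:
  assumes "A \<in> carrier_mat n n" "B \<in> carrier_mat n n" "psd_mat A" "psd_mat B"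
  shows "psd_mat (A \<circ>\<^sub>H B)"
proof -
  have "psd_on {..<n} (\<lambda>i j. A $$ (i, j) * B $$ (i, j))"
    using assms psd_mat_iff_psd_on by (intro psd_on_mult) auto
  moreover have "psd_on {..<n} (\<lambda>i j. (A \<circ>\<^sub>H B) $$ (i, j)) \<longleftrightarrow>
      psd_on {..<n} (\<lambda>i j. A $$ (i, j) * B $$ (i, j))"
    using assms by (simp add: psd_on_def herm_form_def hadamard_def)
  ultimately show ?thesis
    using assms psd_mat_iff_psd_on[of "A \<circ>\<^sub>H B" n] by (simp add: hadamard_def)
qed

lemma psd_mat_oppenheim_schur:
  assumes "A \<in> carrier_mat n n" "B \<in> carrier_mat n n" "psd_mat A" "psd_mat B"
  shows "det A * (\<Prod>i<n. B $$ (i, i)) + det B * (\<Prod>i<n. A $$ (i, i)) \<le> det (A \<circ>\<^sub>H B) + det A * det B"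
proof -
  have "A = mat n n (\<lambda>(i, j). A $$ (i, j))" "B = mat n n (\<lambda>(i, j). B $$ (i, j))"
    "A \<circ>\<^sub>H B = mat n n (\<lambda>(i, j). A $$ (i, j) * B $$ (i, j))"
    using assms by (auto simp: hadamard_def)
  then show ?thesis
    using oppenheim_schur[of n "\<lambda>i j. A $$ (i, j)" "\<lambda>i j. B $$ (i, j)"] assms
      psd_mat_iff_psd_on by metis
qed

text \<open>The two-factor inequality is applied to the product \<open>H\<close> of the first
  \<open>m\<close> matrices and to \<open>A m\<close>. Positive semidefiniteness is carried along in
  the induction so that it applies to \<open>H\<close>.\<close>

lemma oppenheim_schur_hadamard_prod:
  assumes "m \<ge> 2" "\<And>i. i < m \<Longrightarrow> A i \<in> carrier_mat n n" "\<And>i. i < m \<Longrightarrow> psd_mat (A i)"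
  shows "psd_mat (hadamard_prod m A)"
    and "(\<Sum>i<m. (\<Prod>j\<in>{..<m} - {i}. det (A j)) * (\<Prod>r<n. A i $$ (r, r)))
      \<le> det (hadamard_prod m A) + (of_nat m - 1) * (\<Prod>i<m. det (A i))"
proof -
  define d where "d = (\<lambda>i. det (A i))"
  define p where "p = (\<lambda>i. \<Prod>r<n. A i $$ (r, r))"
  have bounds: "0 \<le> d i" "d i \<le> p i" if "i < m" for i
    using psd_mat_det_bounds[of "A i" n] assms(2,3)[OF that] unfolding d_def p_def by blast+
  have "psd_mat (hadamard_prod m A) \<and>
      (\<Sum>i<m. (\<Prod>j\<in>{..<m} - {i}. d j) * p i) \<le> det (hadamard_prod m A) + (of_nat m - 1) * (\<Prod>i<m. d i)"
    using assms bounds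
  proof (induction m rule: nat_induct_at_least)
    case base
    have "hadamard_prod 2 A = A 0 \<circ>\<^sub>H A 1"
      using hadamard_prod_Suc[of 1 A] by (simp add: hadamard_prod_1[unfolded One_nat_def] numeral_2_eq_2)
    moreover have "{..<2 :: nat} = {0, 1}"
      by auto
    moreover have "{0, 1} - {0} = {1 :: nat}" "{0, 1} - {1} = {0 :: nat}"
      by auto
    moreover have "psd_mat (A 0 \<circ>\<^sub>H A 1)"
      using base by (intro psd_mat_hadamard[of _ n]) auto
    moreover have "d 0 * p 1 + d 1 * p 0 \<le> det (A 0 \<circ>\<^sub>H A 1) + d 0 * d 1"
      unfolding d_def p_def using base by (intro psd_mat_oppenheim_schur) auto
    ultimately show ?case
      by (simp add: add.commute)
  next
    case (Suc m)
    define H where "H = hadamard_prod m A"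
    define Q where "Q = (\<Prod>i<m. d i)"
    define P where "P = (\<Prod>i<m. p i)"
    define S where "S = (\<Sum>i<m. (\<Prod>j\<in>{..<m} - {i}. d j) * p i)"
    \<comment> \<open>The lower bound on \<open>det H\<close> from the induction hypothesis; the
      step rests on the chain \<open>Q \<le> L \<le> det H \<le> P\<close>.\<close>
    define L where "L = S - (of_nat m - 1) * Q"
    have H_eq: "H = mat n n (\<lambda>ab. \<Prod>i<m. A i $$ ab)"
      unfolding H_def using Suc.hyps Suc.prems(1) by (intro hadamard_prod_eq_mat) auto
    have "psd_mat H \<and> S \<le> det H + (of_nat m - 1) * Q"
      unfolding H_def S_def Q_def using Suc.prems by (intro Suc.IH) auto
    then have H: "H \<in> carrier_mat n n" "psd_mat H" and LD: "L \<le> det H"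
      by (simp_all add: H_eq L_def diff_le_eq)
    have Am: "A m \<in> carrier_mat n n" "psd_mat (A m)" "0 \<le> d m" "d m \<le> p m"
      using Suc.prems by auto
    have "(\<Prod>r<n. H $$ (r, r)) = (\<Prod>r<n. \<Prod>i<m. A i $$ (r, r))"
      by (simp add: H_eq)
    also have "\<dots> = P"
      unfolding P_def p_def by (rule prod.swap)
    finally have diag: "(\<Prod>r<n. H $$ (r, r)) = P" .
    then have LP: "L \<le> P"
      using LD psd_mat_det_bounds(2)[OF H] by (metis order_trans)
    \<comment> \<open>Each of the \<open>m\<close> summands of \<open>S\<close> is at least
      \<open>Q\<close>, so \<open>S\<close> minus \<open>m - 1\<close> copies of \<open>Q\<close>
      still leaves at least \<open>Q\<close>.\<close>
    have "(\<Sum>i<m. Q) \<le> S"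
      unfolding S_def
    proof (rule sum_mono)
      fix i assume i: "i \<in> {..<m}"
      have "Q = (\<Prod>j\<in>{..<m} - {i}. d j) * d i"
        unfolding Q_def using i by (subst prod.remove[of _ i]) (auto simp: mult.commute)
      moreover have "0 \<le> (\<Prod>j\<in>{..<m} - {i}. d j)" "d i \<le> p i"
        using Suc.prems(3,4) i by (auto intro!: prod_nonneg_complex)
      ultimately show "Q \<le> (\<Prod>j\<in>{..<m} - {i}. d j) * p i"
        by (simp add: mult_left_mono)
    qed
    then have QL: "Q \<le> L"
      by (simp add: L_def algebra_simps)
    have psd: "psd_mat (H \<circ>\<^sub>H A m)"
      using H Am by (intro psd_mat_hadamard)
    have OS: "det H * p m + d m * P \<le> det (H \<circ>\<^sub>H A m) + det H * d m"
      using psd_mat_oppenheim_schur[OF H(1) Am(1) H(2) Am(2)] unfolding diag d_def p_def .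
    \<comment> \<open>The goal amounts to bounding \<open>det (H \<circ>\<^sub>H A m)\<close> below
      by \<open>d m * L + Q * (p m - d m)\<close>. The three summands form the gap between this and
      the two-factor bound; the first and third add up to
      \<open>(det H - Q) * (p m - d m)\<close>.\<close>
    have "0 \<le> (L - Q) * (p m - d m) + d m * (P - L) + (det H - L) * (p m - d m)"
      using QL LP LD Am by (intro add_nonneg_nonneg mult_nonneg_nonneg) simp_all
    also have "\<dots> = det H * p m + d m * P - det H * d m - (d m * L + Q * (p m - d m))"
      by (simp add: algebra_simps)
    finally have "d m * L + Q * (p m - d m) \<le> det H * p m + d m * P - det H * d m"
      by simp
    also have "\<dots> \<le> det (H \<circ>\<^sub>H A m)"
      using OS by (simp add: diff_le_eq)
    finally have main: "d m * L + Q * (p m - d m) \<le> det (H \<circ>\<^sub>H A m)" .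
    \<comment> \<open>Splitting off index \<open>m\<close>: every older summand gains the factor
      \<open>d m\<close>, and the new one has \<open>Q\<close> as its product of
      determinants.\<close>
    have "(\<Sum>i<Suc m. (\<Prod>j\<in>{..<Suc m} - {i}. d j) * p i) =
        (\<Sum>i<m. d m * ((\<Prod>j\<in>{..<m} - {i}. d j) * p i)) + Q * p m"
    proof -
      have "{..<Suc m} - {i} = insert m ({..<m} - {i})" if "i < m" for i
        using that by auto
      moreover have "{..<Suc m} - {m} = {..<m}"
        by auto
      ultimately show ?thesis
        by (simp add: Q_def mult.assoc)
    qed
    also have "\<dots> = d m * S + Q * p m"
      by (simp add: S_def sum_distrib_left)
    also have "\<dots> = d m * L + Q * (p m - d m) + (of_nat (Suc m) - 1) * (\<Prod>i<Suc m. d i)"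
      by (simp add: L_def algebra_simps flip: Q_def)
    also have "\<dots> \<le> det (H \<circ>\<^sub>H A m) + (of_nat (Suc m) - 1) * (\<Prod>i<Suc m. d i)"
      using main by (rule add_right_mono)
    finally show ?case
      using psd hadamard_prod_Suc[of m A] Suc.hyps by (simp add: H_def)
  qed
  then show "psd_mat (hadamard_prod m A)"
    "(\<Sum>i<m. (\<Prod>j\<in>{..<m} - {i}. det (A j)) * (\<Prod>r<n. A i $$ (r, r)))
      \<le> det (hadamard_prod m A) + (of_nat m - 1) * (\<Prod>i<m. det (A i))"
    unfolding d_def p_def by blast+
qed

theorem theorem1p3:
  fixes n k m :: nat and A :: "nat \<Rightarrow> complex mat"
  assumes "n \<ge> 1" and "k \<ge> 1" and "m \<ge> 2"
    and "\<And>i. i < m \<Longrightarrow> A i \<in> carrier_mat (n * k) (n * k)"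
    and "\<And>i. i < m \<Longrightarrow> psd_mat (A i)"
  shows "det (hadamard_prod m A) + (of_nat m - 1) * (\<Prod>i<m. det (A i))
    \<ge> (\<Sum>i<m. (\<Prod>j\<in>{..<m} - {i}. det (A j)) * (\<Prod>\<mu><n. det (block k (A i) \<mu> \<mu>)))"
proof -
  \<comment> \<open>The weights are products of nonnegative determinants, so bounding the block
    products by the diagonal products reduces the claim to block size 1.\<close>
  have "(\<Sum>i<m. (\<Prod>j\<in>{..<m} - {i}. det (A j)) * (\<Prod>\<mu><n. det (block k (A i) \<mu> \<mu>)))
      \<le> (\<Sum>i<m. (\<Prod>j\<in>{..<m} - {i}. det (A j)) * (\<Prod>r<n * k. A i $$ (r, r)))"
  proof (intro sum_mono mult_left_mono)
    fix i assume "i \<in> {..<m}"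
    then show "(\<Prod>\<mu><n. det (block k (A i) \<mu> \<mu>)) \<le> (\<Prod>r<n * k. A i $$ (r, r))"
      using assms by (intro prod_det_block_le) auto
    have "0 \<le> det (A j)" if "j \<in> {..<m} - {i}" for j
      using psd_mat_det_bounds(1)[OF assms(4,5)] that by auto
    then show "0 \<le> (\<Prod>j\<in>{..<m} - {i}. det (A j))"
      by (rule prod_nonneg_complex)
  qed
  also have "\<dots> \<le> det (hadamard_prod m A) + (of_nat m - 1) * (\<Prod>i<m. det (A i))"
    using assms(3,4,5) by (intro oppenheim_schur_hadamard_prod(2)) auto
  finally show ?thesis .
qed

end
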